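(* Let $(z^j)_{j\ge0}$ be generated by the relaxed Peaceman-Rachford iteration with relaxation parameters $(\lambda_j)_{j\ge0}\subset(0,1]$, let $z^\ast$ be a fixed point of $T_{\mathrm{PRS}}$, and let $x^\ast=\mathbf{prox}_{\gamma g}(z^\ast)$. Suppose that $g$ is $\mu_g$-strongly convex and differentiable with $(1/\beta_g)$-Lipschitz gradient, where $\mu_g\beta_g>0$. For $\lambda\in[0,1]$ let $$C(\lambda):=\Big(1-\frac{4\gamma\lambda\mu_g}{(1+\gamma/\beta_g)^2}\Big)^{1/2}.$$ Then for all $k\ge0$, $\|z^{k+1}-z^\ast\|\le C(\lambda_k)\|z^k-z^\ast\|$.
   Context: $\mathcal H$ is a real Hilbert space; $f,g:\mathcal H\to(-\infty,\infty]$ are closed, proper, convex, and there is $x\in\mathcal H$ with $0\in\partial f(x)+\partial g(x)$. Fix $\gamma>0$. $\mathbf{prox}_{\gamma f}(x)=\arg\min_y f(y)+\frac1{2\gamma}\|y-x\|^2$, $\mathbf{refl}_{\gamma f}=2\,\mathbf{prox}_{\gamma f}-I$, $T_{\mathrm{PRS}}=\mathbf{refl}_{\gamma f}\circ\mathbf{refl}_{\gamma g}$. Differentiable means Fréchet differentiable on $\mathcal H$. Relaxed Peaceman-Rachford iteration: $z^0\in\mathcal H$ arbitrary, $z^{k+1}=(1-\lambda_k)z^k+\lambda_kT_{\mathrm{PRS}}z^k$. *)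

theory Defs
  imports "HOL-Analysis.Analysis"
begin

definition extended_epigraph :: "('a \<Rightarrow> ereal) \<Rightarrow> ('a \<times> real) set" where
  "extended_epigraph f = {(x, r). f x \<le> ereal r}"

definition closed_fun :: "('a::topological_space \<Rightarrow> ereal) \<Rightarrow> bool" where
  "closed_fun f \<longleftrightarrow> closed (extended_epigraph f)"

definition proper_fun :: "('a \<Rightarrow> ereal) \<Rightarrow> bool" where
  "proper_fun f \<longleftrightarrow> (\<forall>x. f x \<noteq> -\<infinity>) \<and> (\<exists>x. f x \<noteq> \<infinity>)"

definition convex_fun :: "('a::real_vector \<Rightarrow> ereal) \<Rightarrow> bool" where
  "convex_fun f \<longleftrightarrow> (\<forall>x y. \<forall>t\<in>{0<..<1}.
     f ((1 - t) *\<^sub>R x + t *\<^sub>R y) \<le> ereal (1 - t) * f x + ereal t * f y)"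

definition strongly_convex_fun :: "real \<Rightarrow> ('a::real_normed_vector \<Rightarrow> ereal) \<Rightarrow> bool" where
  "strongly_convex_fun \<mu> f \<longleftrightarrow> (\<forall>x y. \<forall>t\<in>{0<..<1}.
     f ((1 - t) *\<^sub>R x + t *\<^sub>R y) + ereal (\<mu> / 2 * (t * (1 - t)) * (norm (x - y))\<^sup>2)
       \<le> ereal (1 - t) * f x + ereal t * f y)"

definition subdifferential :: "('a::real_inner \<Rightarrow> ereal) \<Rightarrow> 'a \<Rightarrow> 'a set" where
  "subdifferential f x = {u. \<forall>y. f x + ereal (u \<bullet> (y - x)) \<le> f y}"

text \<open>Frechet differentiability on the whole space forces \<open>f\<close> to be finite everywhere.
  \<open>GDERIV h x :> D\<close> says that \<open>h\<close> has the Frechet derivative \<open>\<lambda>v. v \<bullet> D\<close> at \<open>x\<close>; in a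
  Hilbert space, every Frechet derivative of a real function has this form, with \<open>D\<close> the
  gradient.\<close>

definition has_gradient_fun :: "('a::real_inner \<Rightarrow> ereal) \<Rightarrow> ('a \<Rightarrow> 'a) \<Rightarrow> bool" where
  "has_gradient_fun f G \<longleftrightarrow>
     (\<forall>x. \<bar>f x\<bar> \<noteq> \<infinity>) \<and> (\<forall>x. GDERIV (\<lambda>y. real_of_ereal (f y)) x :> G x)"

definition differentiable_with_lipschitz_gradient ::
    "real \<Rightarrow> ('a::real_inner \<Rightarrow> ereal) \<Rightarrow> bool" where
  "differentiable_with_lipschitz_gradient L f \<longleftrightarrow>
     (\<exists>G. has_gradient_fun f G \<and> L-lipschitz_on UNIV G)"

definition prox :: "real \<Rightarrow> ('a::real_normed_vector \<Rightarrow> ereal) \<Rightarrow> 'a \<Rightarrow> 'a" where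
  "prox \<gamma> f x = arg_min (\<lambda>y. f y + ereal (1 / (2 * \<gamma>) * (norm (y - x))\<^sup>2)) (\<lambda>_. True)"

definition refl_prox :: "real \<Rightarrow> ('a::real_normed_vector \<Rightarrow> ereal) \<Rightarrow> 'a \<Rightarrow> 'a" where
  "refl_prox \<gamma> f x = 2 *\<^sub>R prox \<gamma> f x - x"

definition T_PRS ::
    "real \<Rightarrow> ('a::real_normed_vector \<Rightarrow> ereal) \<Rightarrow> ('a \<Rightarrow> ereal) \<Rightarrow> 'a \<Rightarrow> 'a" where
  "T_PRS \<gamma> f g = refl_prox \<gamma> f \<circ> refl_prox \<gamma> g"

definition relaxed_PRS_iteration ::
    "real \<Rightarrow> ('a::real_normed_vector \<Rightarrow> ereal) \<Rightarrow> ('a \<Rightarrow> ereal) \<Rightarrow> (nat \<Rightarrow> real) \<Rightarrow> (nat \<Rightarrow> 'a) \<Rightarrow> bool"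
  where
  "relaxed_PRS_iteration \<gamma> f g lam z \<longleftrightarrow>
     (\<forall>k. z (Suc k) = (1 - lam k) *\<^sub>R z k + lam k *\<^sub>R T_PRS \<gamma> f g (z k))"

definition PRS_rate :: "real \<Rightarrow> real \<Rightarrow> real \<Rightarrow> real \<Rightarrow> real" where
  "PRS_rate \<gamma> \<mu> \<beta> l = sqrt (1 - 4 * \<gamma> * l * \<mu> / (1 + \<gamma> / \<beta>)\<^sup>2)"

end

theory Submission
  imports Defs
begin

text \<open>
  Write \<open>x = prox \<gamma> g z\<close>. Then \<open>z = x + \<gamma> \<nabla>g(x)\<close> and \<open>refl z = x - \<gamma> \<nabla>g(x)\<close>, so for two
  points \<open>z, z'\<close> the quantity \<open>\<parallel>z - z'\<parallel>\<^sup>2 - \<parallel>refl z - refl z'\<parallel>\<^sup>2\<close> equals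
  \<open>4 \<gamma> \<langle>x - x', \<nabla>g(x) - \<nabla>g(x')\<rangle> \<ge> 4 \<gamma> \<mu> \<parallel>x - x'\<parallel>\<^sup>2\<close>, while the Lipschitz bound gives
  \<open>\<parallel>z - z'\<parallel> \<le> (1 + \<gamma>/\<beta>) \<parallel>x - x'\<parallel>\<close>. Hence the reflection in \<open>g\<close> is a strict contraction; the
  reflection in \<open>f\<close> is nonexpansive, and convexity of the squared norm handles the relaxation.
\<close>

section \<open>Preliminaries on subgradients and limits\<close>

text \<open>At a point of value infinity the subgradient inequality would force the value infinity
  everywhere, which properness excludes.\<close>

lemma subdifferential_imp_finite:
  assumes "proper_fun f" "u \<in> subdifferential f x"
  shows "\<bar>f x\<bar> \<noteq> \<infinity>"
proof -
  have "f x \<noteq> \<infinity>"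
  proof
    assume "f x = \<infinity>"
    then have "f y = \<infinity>" for y
      using assms(2)[unfolded subdifferential_def, THEN CollectD, THEN spec, of y] by simp
    then show False
      using assms(1) by (auto simp: proper_fun_def)
  qed
  then show ?thesis
    using assms(1) by (auto simp: proper_fun_def)
qed

text \<open>Lets the monotonicity result for strongly convex functions serve \<open>f\<close> as
  well, with modulus zero.\<close>

lemma strongly_convex_0_iff: "strongly_convex_fun 0 f \<longleftrightarrow> convex_fun f"
  by (simp add: strongly_convex_fun_def convex_fun_def zero_ereal_def[symmetric])

text \<open>Used twice below for first-order arguments along a segment: divide by \<open>t\<close>,
  then let \<open>t\<close> tend to 0 from the right.\<close>

lemma le_if_le_add_small_multiple:
  fixes a b c :: real
  assumes "\<And>t. \<lbrakk>0 < t; t < 1\<rbrakk> \<Longrightarrow> a \<le> b + t * c"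
  shows "a \<le> b"
proof (rule tendsto_lowerbound)
  show "((\<lambda>t. b + t * c) \<longlongrightarrow> b) (at_right 0)"
    by (auto intro!: tendsto_eq_intros)
  show "\<forall>\<^sub>F t in at_right 0. a \<le> b + t * c"
    unfolding eventually_at_right_field using assms by (auto intro!: exI[of _ 1])
qed simp

section \<open>Existence and optimality of proximal points\<close>

text \<open>Direct method: the affine minorant given by \<open>u\<close> bounds the objective below,
  the parallelogram law makes a minimizing sequence Cauchy, and closedness of the epigraph passes to
  the limit. Minimizing over epigraph pairs keeps the infimum real-valued.\<close>

lemma prox_minimizer_exists:
  fixes f :: "'a::{real_inner, complete_space} \<Rightarrow> ereal"
  assumes closed: "closed_fun f" and proper: "proper_fun f" and convex: "convex_fun f"
    and u: "u \<in> subdifferential f x0" and c: "c > 0"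
  shows "\<exists>p. \<forall>y. f p + ereal (c * (norm (p - x))\<^sup>2) \<le> f y + ereal (c * (norm (y - x))\<^sup>2)"
proof -
  define E where "E = extended_epigraph f"
  define v where "v = (\<lambda>(y, r). r + c * (norm (y - x))\<^sup>2)"
  obtain a where a: "f x0 = ereal a"
    using subdifferential_imp_finite[OF proper u] by (cases "f x0") auto
  have "(x0, a) \<in> E"
    by (simp add: E_def extended_epigraph_def a)
  \<comment> \<open>The constant comes from completing the square:
    \<open>- (norm u)\<^sup>2 / (4 * c)\<close> is the minimum of
    \<open>u \<bullet> h + c * (norm h)\<^sup>2\<close> over \<open>h\<close>.\<close>
  have "a + u \<bullet> (x - x0) - (norm u)\<^sup>2 / (4 * c) \<le> v w" if "w \<in> E" for w
  proof -
    obtain y r where w: "w = (y, r)"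
      by fastforce
    have "f x0 + ereal (u \<bullet> (y - x0)) \<le> f y" "f y \<le> ereal r"
      using u that by (auto simp: subdifferential_def E_def extended_epigraph_def w)
    then have "ereal (a + u \<bullet> (y - x0)) \<le> ereal r"
      unfolding a by (metis order_trans plus_ereal.simps(1))
    then have *: "a + u \<bullet> (x - x0) + u \<bullet> (y - x) \<le> r"
      by (simp add: inner_diff_right)
    have "0 \<le> (norm (u + (2 * c) *\<^sub>R (y - x)))\<^sup>2 / (4 * c)"
      using c by simp
    also have "\<dots> = (norm u)\<^sup>2 / (4 * c) + u \<bullet> (y - x) + c * (norm (y - x))\<^sup>2"
      unfolding power2_norm_eq_inner inner_add_left inner_add_right inner_scaleR_left
        inner_scaleR_right inner_commute[of "y - x" u]
      using c by (simp add: field_simps)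
    finally show ?thesis
      using * by (simp add: w v_def)
  qed
  then have bdd: "bdd_below (v ` E)"
    by (meson bdd_belowI2)
  define m where "m = Inf (v ` E)"
  have m: "m \<le> v w" if "w \<in> E" for w
    unfolding m_def using bdd that by (simp add: cInf_lower)
  have "\<exists>w\<in>E. v w < m + inverse (real (Suc n))" for n
    using cInf_lessD[of "v ` E" "m + inverse (real (Suc n))"] \<open>(x0, a) \<in> E\<close>
    unfolding m_def by auto
  then obtain w where w: "\<And>n. w n \<in> E" "\<And>n. v (w n) < m + inverse (real (Suc n))"
    by metis
  define y where "y n = fst (w n)" for n
  define r where "r n = snd (w n)" for n
  have wyr: "w n = (y n, r n)" for n
    by (simp add: y_def r_def)
  have v_lim: "(\<lambda>n. v (w n)) \<longlonglongrightarrow> m"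
  proof (rule tendsto_sandwich[where f = "\<lambda>_. m"])
    show "(\<lambda>n. m + inverse (real (Suc n))) \<longlonglongrightarrow> m"
      using tendsto_add[OF tendsto_const LIMSEQ_inverse_real_of_nat, of m]
      by (simp only: add_0_right)
      show "\<forall>\<^sub>F n in sequentially. m \<le> v (w n)"
      using m w(1) by simp
    show "\<forall>\<^sub>F n in sequentially. v (w n) \<le> m + inverse (real (Suc n))"
      using w(2) less_imp_le by (blast intro: always_eventually)
  qed simp
  \<comment> \<open>The midpoint of two epigraph points lies in the epigraph, so its value is at
    least \<open>m\<close>; the parallelogram law turns this into a bound on the distance.\<close>
  have gap: "c * (norm (y i - y j))\<^sup>2 \<le> 2 * (v (w i) - m) + 2 * (v (w j) - m)" for i j
  proof -
    define q where "q = (1 - 1/2) *\<^sub>R y i + (1/2) *\<^sub>R y j"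
    have "f q \<le> ereal (1 - 1/2) * f (y i) + ereal (1/2) * f (y j)"
      using convex[unfolded convex_fun_def, rule_format, of "1/2" "y i" "y j"]
      by (simp only: q_def) simp
    also have "\<dots> \<le> ereal (1 - 1/2) * ereal (r i) + ereal (1/2) * ereal (r j)"
      using w(1)[of i] w(1)[of j]
      by (intro add_mono ereal_mult_left_mono) (auto simp: wyr E_def extended_epigraph_def)
    finally have "(q, (r i + r j) / 2) \<in> E"
      by (simp add: E_def extended_epigraph_def field_simps)
    from m[OF this] have "m \<le> (r i + r j) / 2 + c * (norm (q - x))\<^sup>2"
      by (simp add: v_def)
    moreover have "4 * (norm (q - x))\<^sup>2 =
        2 * (norm (y i - x))\<^sup>2 + 2 * (norm (y j - x))\<^sup>2 - (norm (y i - y j))\<^sup>2"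
      unfolding q_def power2_norm_eq_inner
      by (simp add: inner_add_left inner_add_right inner_diff_left inner_diff_right
          inner_commute algebra_simps)
    then have "4 * (c * (norm (q - x))\<^sup>2) = 2 * (c * (norm (y i - x))\<^sup>2)
        + 2 * (c * (norm (y j - x))\<^sup>2) - c * (norm (y i - y j))\<^sup>2"
      by algebra
    ultimately show ?thesis
      unfolding wyr v_def prod.case by argo
  qed
  have "Cauchy y"
  proof (rule metric_CauchyI)
    fix e :: real
    assume "e > 0"
    \<comment> \<open>With this tolerance the two summands in \<open>gap\<close> add up to less than
      \<open>c * e\<^sup>2\<close>.\<close>
    then have "\<forall>\<^sub>F n in sequentially. v (w n) < m + c * e\<^sup>2 / 4"
      using c by (intro order_tendstoD(2)[OF v_lim]) simp
    then obtain N where N: "\<And>n. n \<ge> N \<Longrightarrow> v (w n) < m + c * e\<^sup>2 / 4"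
      by (auto simp: eventually_sequentially)
    have "dist (y i) (y j) < e" if "i \<ge> N" "j \<ge> N" for i j
    proof -
      have "c * (norm (y i - y j))\<^sup>2 < c * e\<^sup>2"
        using gap[of i j] N[OF that(1)] N[OF that(2)] by argo
      then show ?thesis
        using c \<open>e > 0\<close> by (simp add: dist_norm power_less_imp_less_base)
    qed
    then show "\<exists>N. \<forall>i\<ge>N. \<forall>j\<ge>N. dist (y i) (y j) < e"
      by blast
  qed
  then obtain p where p: "y \<longlonglongrightarrow> p"
    using Cauchy_convergent convergent_def by blast
  \<comment> \<open>Convergence of the heights \<open>r\<close> is recovered by subtracting the
    convergent quadratic term from the values of \<open>v\<close>.\<close>
  have "(\<lambda>n. v (w n) - c * (norm (y n - x))\<^sup>2) \<longlonglongrightarrow> m - c * (norm (p - x))\<^sup>2"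
    by (intro tendsto_intros v_lim p)
  then have "r \<longlonglongrightarrow> m - c * (norm (p - x))\<^sup>2"
    by (simp add: wyr v_def)
  then have "(\<lambda>n. (y n, r n)) \<longlonglongrightarrow> (p, m - c * (norm (p - x))\<^sup>2)"
    using p by (intro tendsto_Pair)
  moreover have "closed E"
    using closed by (simp add: closed_fun_def E_def)
  ultimately have "(p, m - c * (norm (p - x))\<^sup>2) \<in> E"
    using w(1) unfolding wyr by (meson closed_sequentially)
  then have "f p \<le> ereal (m - c * (norm (p - x))\<^sup>2)"
    by (simp add: E_def extended_epigraph_def)
  then have "f p + ereal (c * (norm (p - x))\<^sup>2) \<le> ereal m"
    by (cases "f p") auto
  moreover have "ereal m \<le> f y' + ereal (c * (norm (y' - x))\<^sup>2)" for y'
  proof (cases "f y'")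
    case (real s)
    then have "(y', s) \<in> E"
      by (simp add: E_def extended_epigraph_def)
    from m[OF this] show ?thesis
      by (simp add: v_def real)
  qed (use proper in \<open>auto simp: proper_fun_def\<close>)
  ultimately show ?thesis
    using order_trans by blast
qed

text \<open>The minimizer is compared with points on the segment towards an arbitrary
  \<open>y\<close>; the first-order term in \<open>t\<close> is the subgradient inequality.\<close>

lemma prox_optimality:
  fixes f :: "'a::{real_inner, complete_space} \<Rightarrow> ereal"
  assumes closed: "closed_fun f" and proper: "proper_fun f" and convex: "convex_fun f"
    and u: "u \<in> subdifferential f x0" and \<gamma>: "\<gamma> > 0"
  shows "(1 / \<gamma>) *\<^sub>R (x - prox \<gamma> f x) \<in> subdifferential f (prox \<gamma> f x)"
proof -
  define p where "p = prox \<gamma> f x"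
  define c where "c = 1 / (2 * \<gamma>)"
  have c: "c > 0"
    using \<gamma> by (simp add: c_def)
  let ?\<phi> = "\<lambda>y. f y + ereal (c * (norm (y - x))\<^sup>2)"
  obtain q where "\<And>y. ?\<phi> q \<le> ?\<phi> y"
    using prox_minimizer_exists[OF closed proper convex u c] by blast
  then have "is_arg_min ?\<phi> (\<lambda>_. True) q"
    by (simp add: is_arg_min_linorder)
  \<comment> \<open>\<open>prox\<close> is defined by choice, so it is a minimizer only because one
    exists.\<close>
  then have "is_arg_min ?\<phi> (\<lambda>_. True) p"
    unfolding p_def prox_def arg_min_def c_def by (rule someI)
  then have min: "?\<phi> p \<le> ?\<phi> y" for y
    by (simp add: is_arg_min_linorder)
  obtain a where a: "f x0 = ereal a"
    using subdifferential_imp_finite[OF proper u] by (cases "f x0") auto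
  have "f p \<noteq> \<infinity>" "f p \<noteq> -\<infinity>"
    using min[of x0] proper by (auto simp: a proper_fun_def)
  then obtain b where b: "f p = ereal b"
    by (cases "f p") auto
  have "f p + ereal ((1 / \<gamma>) *\<^sub>R (x - p) \<bullet> (y - p)) \<le> f y" for y
  proof (cases "f y")
    case (real s)
    have "b + (1 / \<gamma>) *\<^sub>R (x - p) \<bullet> (y - p) \<le> s"
    proof (rule le_if_le_add_small_multiple)
      fix t :: real
      assume t: "0 < t" "t < 1"
      define q where "q = (1 - t) *\<^sub>R p + t *\<^sub>R y"
      have "f q \<le> ereal (1 - t) * f p + ereal t * f y"
        using convex t by (simp add: convex_fun_def q_def)
      then have fq: "f q \<le> ereal ((1 - t) * b + t * s)"
        by (simp add: b real)
      have "ereal (b + c * (norm (p - x))\<^sup>2) \<le> f q + ereal (c * (norm (q - x))\<^sup>2)"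
        using min[of q] by (simp add: b)
      also have "\<dots> \<le> ereal ((1 - t) * b + t * s + c * (norm (q - x))\<^sup>2)"
        using add_right_mono[OF fq, of "ereal (c * (norm (q - x))\<^sup>2)"] by simp
      finally have *: "b + c * (norm (p - x))\<^sup>2 \<le> (1 - t) * b + t * s + c * (norm (q - x))\<^sup>2"
        by simp
      have "q - x = (p - x) + t *\<^sub>R (y - p)"
        by (simp add: q_def algebra_simps)
      then have **: "(norm (q - x))\<^sup>2 =
          (norm (p - x))\<^sup>2 - 2 * t * ((x - p) \<bullet> (y - p)) + t\<^sup>2 * (norm (y - p))\<^sup>2"
        by (simp only: power2_norm_eq_inner inner_add_left inner_add_right inner_diff_left
            inner_diff_right inner_scaleR_left inner_scaleR_right)
          (simp add: inner_commute algebra_simps power2_eq_square)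
      \<comment> \<open>After cancelling the common quadratic term, everything carries a factor
        \<open>t\<close>, and the remaining error is still of order \<open>t\<close> once that
        factor is removed. The subgradient appears since \<open>2 * c\<close> is
        \<open>1 / \<gamma>\<close>.\<close>
      have "t * (b + 2 * c * ((x - p) \<bullet> (y - p))) \<le> t * (s + t * (c * (norm (y - p))\<^sup>2))"
        using * unfolding ** by (simp add: algebra_simps power2_eq_square)
      then show "b + (1 / \<gamma>) *\<^sub>R (x - p) \<bullet> (y - p) \<le> s + t * (c * (norm (y - p))\<^sup>2)"
        using t by (simp add: c_def)
    qed
    then show ?thesis
      by (simp add: b real)
  qed (use proper in \<open>auto simp: proper_fun_def\<close>)
  then show ?thesis
    by (simp add: subdifferential_def p_def)
qed

section \<open>Strong convexity, monotonicity and gradients\<close>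

text \<open>At a point of the segment, the subgradient bounds \<open>f\<close> below and strong
  convexity bounds it above. Dividing by \<open>t\<close> leaves the modulus with factor
  \<open>1 - t\<close>, which tends to 1.\<close>

lemma strongly_convex_subdifferential_growth:
  assumes proper: "proper_fun f" and sc: "strongly_convex_fun \<mu> f"
    and u: "u \<in> subdifferential f x"
  shows "f x + ereal (u \<bullet> (y - x) + \<mu> / 2 * (norm (x - y))\<^sup>2) \<le> f y"
proof -
  obtain a where a: "f x = ereal a"
    using subdifferential_imp_finite[OF proper u] by (cases "f x") auto
  show ?thesis
  proof (cases "f y")
    case (real b)
    have "a + (u \<bullet> (y - x) + \<mu> / 2 * (norm (x - y))\<^sup>2) \<le> b"
    proof (rule le_if_le_add_small_multiple)
      fix t :: real
      assume t: "0 < t" "t < 1"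
      define q where "q = (1 - t) *\<^sub>R x + t *\<^sub>R y"
      have "f x + ereal (u \<bullet> (q - x)) \<le> f q"
        using u by (simp add: subdifferential_def)
      moreover have "q - x = t *\<^sub>R (y - x)"
        by (simp add: q_def algebra_simps)
      ultimately have "ereal (a + t * (u \<bullet> (y - x))) \<le> f q"
        by (simp add: a)
      then have "ereal (a + t * (u \<bullet> (y - x))) + ereal (\<mu> / 2 * (t * (1 - t)) * (norm (x - y))\<^sup>2)
          \<le> f q + ereal (\<mu> / 2 * (t * (1 - t)) * (norm (x - y))\<^sup>2)"
        by (rule add_right_mono)
      also have "\<dots> \<le> ereal (1 - t) * f x + ereal t * f y"
        using sc t unfolding strongly_convex_fun_def q_def by simp
      finally have "a + t * (u \<bullet> (y - x)) + \<mu> / 2 * (t * (1 - t)) * (norm (x - y))\<^sup>2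
          \<le> (1 - t) * a + t * b"
        by (simp add: a real)
      then have "t * (a + (u \<bullet> (y - x) + \<mu> / 2 * (norm (x - y))\<^sup>2))
          \<le> t * (b + t * (\<mu> / 2 * (norm (x - y))\<^sup>2))"
        by (simp add: field_simps)
      then show "a + (u \<bullet> (y - x) + \<mu> / 2 * (norm (x - y))\<^sup>2)
          \<le> b + t * (\<mu> / 2 * (norm (x - y))\<^sup>2)"
        using t by simp
    qed
    then show ?thesis
      by (simp add: a real)
  qed (use proper in \<open>auto simp: proper_fun_def\<close>)
qed

text \<open>Adding the growth inequalities at \<open>x\<close> and at \<open>y\<close> cancels the
  function values.\<close>

lemma subdifferential_strongly_monotone:
  assumes proper: "proper_fun f" and sc: "strongly_convex_fun \<mu> f"
    and u: "u \<in> subdifferential f x" and v: "v \<in> subdifferential f y"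
  shows "\<mu> * (norm (x - y))\<^sup>2 \<le> (u - v) \<bullet> (x - y)"
proof -
  obtain a b where ab: "f x = ereal a" "f y = ereal b"
    using subdifferential_imp_finite[OF proper u] subdifferential_imp_finite[OF proper v]
    by (cases "f x"; cases "f y") auto
  show ?thesis
    using strongly_convex_subdifferential_growth[OF proper sc u, of y]
      strongly_convex_subdifferential_growth[OF proper sc v, of x]
    by (simp add: ab norm_minus_commute[of y x] inner_diff_left inner_diff_right)
qed

text \<open>Subtracting the linear part from \<open>f\<close> gives a function minimal at
  \<open>x\<close>, so its derivative vanishes there. This transfers the Lipschitz bound on
  \<open>G\<close> to the subgradients produced by \<open>prox\<close>.\<close>

lemma subdifferential_gradient:
  assumes G: "has_gradient_fun f G" and u: "u \<in> subdifferential f x"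
  shows "u = G x"
proof -
  let ?h = "\<lambda>y. real_of_ereal (f y) - u \<bullet> (y - x)"
  have fin: "f y = ereal (real_of_ereal (f y))" for y
    using G by (simp add: has_gradient_fun_def ereal_real)
  have "f x + ereal (u \<bullet> (y - x)) \<le> f y" for y
    using u by (simp add: subdifferential_def)
  then have "ereal (real_of_ereal (f x) + u \<bullet> (y - x)) \<le> ereal (real_of_ereal (f y))" for y
    using fin by (metis plus_ereal.simps(1))
  then have min: "?h x \<le> ?h y" for y
    by (simp add: algebra_simps)
  have "((\<lambda>y. real_of_ereal (f y)) has_derivative (\<lambda>v. v \<bullet> G x)) (at x)"
    using G by (simp add: has_gradient_fun_def gderiv_def)
  then have "(?h has_derivative (\<lambda>v. v \<bullet> G x - u \<bullet> v)) (at x)"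
    by (auto intro!: derivative_eq_intros)
  then have "(\<lambda>v. v \<bullet> G x - u \<bullet> v) = (\<lambda>v. 0)"
    by (rule has_derivative_local_min) (use min in simp)
  \<comment> \<open>The vanishing derivative is evaluated in the direction
    \<open>G x - u\<close>.\<close>
  then have "(G x - u) \<bullet> G x - u \<bullet> (G x - u) = 0"
    by meson
  then have "(G x - u) \<bullet> (G x - u) = 0"
    by (simp add: inner_diff_left inner_diff_right inner_commute)
  then show ?thesis
    by simp
qed

section \<open>Nonexpansive and contractive reflections\<close>

text \<open>Expansion of a square. The factors \<open>1 / \<gamma>\<close> are inserted so that the
  subgradients of \<open>prox_optimality\<close> appear.\<close>

lemma norm_refl_prox_diff:
  assumes "\<gamma> > 0"
  shows "(norm (refl_prox \<gamma> f x - refl_prox \<gamma> f y))\<^sup>2 = (norm (x - y))\<^sup>2 -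
    4 * \<gamma> * (((1 / \<gamma>) *\<^sub>R (x - prox \<gamma> f x) - (1 / \<gamma>) *\<^sub>R (y - prox \<gamma> f y)) \<bullet>
      (prox \<gamma> f x - prox \<gamma> f y))"
proof -
  define d where "d = x - y"
  define e where "e = prox \<gamma> f x - prox \<gamma> f y"
  have "refl_prox \<gamma> f x - refl_prox \<gamma> f y = 2 *\<^sub>R e - d"
    by (simp add: refl_prox_def d_def e_def scaleR_diff_right)
  moreover have "(1 / \<gamma>) *\<^sub>R (x - prox \<gamma> f x) - (1 / \<gamma>) *\<^sub>R (y - prox \<gamma> f y) = (1 / \<gamma>) *\<^sub>R (d - e)"
    by (simp add: d_def e_def algebra_simps)
  moreover have "(norm (2 *\<^sub>R e - d))\<^sup>2 = (norm d)\<^sup>2 - 4 * ((d - e) \<bullet> e)"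
    by (simp add: power2_norm_eq_inner inner_diff_left inner_diff_right inner_commute)
  ultimately show ?thesis
    using assms by (simp add: d_def e_def)
qed

text \<open>The inner product subtracted in \<open>norm_refl_prox_diff\<close> is nonnegative by
  monotonicity of the subdifferential.\<close>

lemma refl_prox_nonexpansive:
  fixes f :: "'a::{real_inner, complete_space} \<Rightarrow> ereal"
  assumes f: "closed_fun f" "proper_fun f" "convex_fun f" "u \<in> subdifferential f x0"
    and \<gamma>: "\<gamma> > 0"
  shows "norm (refl_prox \<gamma> f x - refl_prox \<gamma> f y) \<le> norm (x - y)"
proof -
  have "0 \<le> ((1 / \<gamma>) *\<^sub>R (x - prox \<gamma> f x) - (1 / \<gamma>) *\<^sub>R (y - prox \<gamma> f y)) \<bullet>
      (prox \<gamma> f x - prox \<gamma> f y)"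
    using subdifferential_strongly_monotone[OF f(2) _ prox_optimality[OF f \<gamma>]
        prox_optimality[OF f \<gamma>], of 0 x y] f(3)
    by (simp add: strongly_convex_0_iff)
  then have "(norm (refl_prox \<gamma> f x - refl_prox \<gamma> f y))\<^sup>2 \<le> (norm (x - y))\<^sup>2"
    unfolding norm_refl_prox_diff[OF \<gamma>, of f x y] using \<gamma>
    by (metis diff_add_cancel le_add_same_cancel1 less_imp_le mult_nonneg_nonneg zero_le_numeral)
  then show ?thesis
    using norm_ge_zero by (rule power2_le_imp_le)
qed

lemma refl_prox_contraction:
  fixes g :: "'a::{real_inner, complete_space} \<Rightarrow> ereal"
  assumes g: "closed_fun g" "proper_fun g" "convex_fun g" "u \<in> subdifferential g x0"
    and \<gamma>: "\<gamma> > 0" and \<mu>: "\<mu> \<ge> 0" and sc: "strongly_convex_fun \<mu> g"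
    and G: "has_gradient_fun g G" and L: "L-lipschitz_on UNIV G"
  shows "(norm (refl_prox \<gamma> g x - refl_prox \<gamma> g y))\<^sup>2
    \<le> (1 - 4 * \<gamma> * \<mu> / (1 + \<gamma> * L)\<^sup>2) * (norm (x - y))\<^sup>2"
proof -
  define p where "p = prox \<gamma> g x"
  define q where "q = prox \<gamma> g y"
  define a where "a = (1 / \<gamma>) *\<^sub>R (x - p)"
  define b where "b = (1 / \<gamma>) *\<^sub>R (y - q)"
  have a: "a \<in> subdifferential g p" and b: "b \<in> subdifferential g q"
    using prox_optimality[OF g \<gamma>] by (auto simp: a_def b_def p_def q_def)
  have "L \<ge> 0"
    using L by (rule lipschitz_on_nonneg)
  then have pos: "1 + \<gamma> * L > 0"
    using \<gamma> by (simp add: add_pos_nonneg)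
  have "norm (a - b) \<le> L * norm (p - q)"
    using lipschitz_onD[OF L, of p q] subdifferential_gradient[OF G a]
      subdifferential_gradient[OF G b] by (simp add: dist_norm)
  moreover have "x - y = (p - q) + \<gamma> *\<^sub>R (a - b)"
    using \<gamma> by (simp add: a_def b_def algebra_simps)
  then have "norm (x - y) \<le> norm (p - q) + \<gamma> * norm (a - b)"
    using norm_triangle_ineq[of "p - q" "\<gamma> *\<^sub>R (a - b)"] \<gamma> by simp
  ultimately have "norm (x - y) \<le> norm (p - q) + \<gamma> * (L * norm (p - q))"
    using \<gamma> by (meson add_left_mono less_imp_le mult_left_mono order_trans)
  then have "norm (x - y) \<le> (1 + \<gamma> * L) * norm (p - q)"
    by (simp add: algebra_simps)
  then have "(norm (x - y))\<^sup>2 \<le> (1 + \<gamma> * L)\<^sup>2 * (norm (p - q))\<^sup>2"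
    by (metis norm_ge_zero power_mono power_mult_distrib)
  \<comment> \<open>The Lipschitz estimate is read as a lower bound on the distance of the proximal
    points, which strong monotonicity can use.\<close>
  then have "(norm (x - y))\<^sup>2 / (1 + \<gamma> * L)\<^sup>2 \<le> (norm (p - q))\<^sup>2"
    using pos by (simp add: divide_le_eq mult.commute)
  then have "\<mu> * ((norm (x - y))\<^sup>2 / (1 + \<gamma> * L)\<^sup>2) \<le> \<mu> * (norm (p - q))\<^sup>2"
    using \<mu> by (rule mult_left_mono)
  also have "\<dots> \<le> (a - b) \<bullet> (p - q)"
    by (rule subdifferential_strongly_monotone[OF g(2) sc a b])
  finally have "4 * \<gamma> * (\<mu> * ((norm (x - y))\<^sup>2 / (1 + \<gamma> * L)\<^sup>2)) \<le> 4 * \<gamma> * ((a - b) \<bullet> (p - q))"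
    using \<gamma> by (intro mult_left_mono) simp_all
  then show ?thesis
    using norm_refl_prox_diff[OF \<gamma>, of g x y]
    by (simp add: a_def b_def p_def q_def left_diff_distrib)
qed

section \<open>Relaxation and the rate\<close>

text \<open>The two sides differ by exactly
  \<open>t * (1 - t) * (norm (a - b))\<^sup>2\<close>.\<close>

lemma norm_convex_combination_squared_le:
  fixes a b :: "'a::real_inner"
  assumes "0 \<le> t" "t \<le> 1"
  shows "(norm ((1 - t) *\<^sub>R a + t *\<^sub>R b))\<^sup>2 \<le> (1 - t) * (norm a)\<^sup>2 + t * (norm b)\<^sup>2"
proof -
  have "(norm ((1 - t) *\<^sub>R a + t *\<^sub>R b))\<^sup>2 =
      (1 - t) * (norm a)\<^sup>2 + t * (norm b)\<^sup>2 - t * (1 - t) * (norm (a - b))\<^sup>2"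
    by (simp add: power2_norm_eq_inner inner_add_left inner_add_right inner_diff_left
        inner_diff_right inner_commute algebra_simps)
  then show ?thesis
    using assms by simp
qed

theorem theorem5:
  fixes f g :: "'a::{real_inner, complete_space} \<Rightarrow> ereal"
    and \<gamma> \<mu>\<^sub>g \<beta>\<^sub>g :: real
    and lam :: "nat \<Rightarrow> real"
    and z :: "nat \<Rightarrow> 'a"
    and zstar xstar :: 'a
  assumes "closed_fun f" "proper_fun f" "convex_fun f"
    and "closed_fun g" "proper_fun g" "convex_fun g"
    and "\<exists>x. 0 \<in> subdifferential f x + subdifferential g x"
    and "\<gamma> > 0"
    and "\<And>j. lam j \<in> {0<..1}"
    and "relaxed_PRS_iteration \<gamma> f g lam z"
    and "T_PRS \<gamma> f g zstar = zstar"
    and "xstar = prox \<gamma> g zstar"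
    and "\<mu>\<^sub>g \<ge> 0" "\<beta>\<^sub>g \<ge> 0" "\<mu>\<^sub>g * \<beta>\<^sub>g > 0"
    and "strongly_convex_fun \<mu>\<^sub>g g"
    and "differentiable_with_lipschitz_gradient (1 / \<beta>\<^sub>g) g"
  shows "\<forall>k. norm (z (k + 1) - zstar) \<le> PRS_rate \<gamma> \<mu>\<^sub>g \<beta>\<^sub>g (lam k) * norm (z k - zstar)"
proof
  fix k
  \<comment> \<open>The solution \<open>x\<close> supplies subgradients of both functions, hence the
    affine minorants behind the existence of both proximal points.\<close>
  obtain x u v where u: "u \<in> subdifferential f x" and v: "v \<in> subdifferential g x"
    using assms(7) by (auto elim!: set_plus_elim)
  obtain G where G: "has_gradient_fun g G" "(1 / \<beta>\<^sub>g)-lipschitz_on UNIV G"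
    using assms(17) by (auto simp: differentiable_with_lipschitz_gradient_def)
  define d where "d = z k - zstar"
  define e where "e = T_PRS \<gamma> f g (z k) - zstar"
  have lam: "0 < lam k" "lam k \<le> 1"
    using assms(9)[of k] by auto
  have "norm e = norm (T_PRS \<gamma> f g (z k) - T_PRS \<gamma> f g zstar)"
    by (simp add: e_def assms(11))
  also have "\<dots> \<le> norm (refl_prox \<gamma> g (z k) - refl_prox \<gamma> g zstar)"
    unfolding T_PRS_def comp_def
    by (rule refl_prox_nonexpansive[OF assms(1-3) u assms(8)])
  finally have "(norm e)\<^sup>2 \<le> (norm (refl_prox \<gamma> g (z k) - refl_prox \<gamma> g zstar))\<^sup>2"
    by (simp add: power_mono)
  also have "\<dots> \<le> (1 - 4 * \<gamma> * \<mu>\<^sub>g / (1 + \<gamma> * (1 / \<beta>\<^sub>g))\<^sup>2) * (norm d)\<^sup>2"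
    unfolding d_def by (rule refl_prox_contraction[OF assms(4-6) v assms(8,13,16) G])
  finally have "lam k * (norm e)\<^sup>2 \<le> lam k * ((1 - 4 * \<gamma> * \<mu>\<^sub>g / (1 + \<gamma> / \<beta>\<^sub>g)\<^sup>2) * (norm d)\<^sup>2)"
    using lam by simp
  moreover have "z (k + 1) - zstar = (1 - lam k) *\<^sub>R d + lam k *\<^sub>R e"
    using assms(10) by (simp add: relaxed_PRS_iteration_def d_def e_def algebra_simps)
  then have "(norm (z (k + 1) - zstar))\<^sup>2 \<le> (1 - lam k) * (norm d)\<^sup>2 + lam k * (norm e)\<^sup>2"
    using norm_convex_combination_squared_le[of "lam k" d e] lam by simp
  \<comment> \<open>Averaging the factors 1 and \<open>1 - s\<close> with weights
    \<open>1 - lam k\<close> and \<open>lam k\<close> gives \<open>1 - lam k * s\<close>, which is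
    how the relaxation parameter enters the rate.\<close>
  ultimately have "(norm (z (k + 1) - zstar))\<^sup>2
      \<le> (1 - 4 * \<gamma> * lam k * \<mu>\<^sub>g / (1 + \<gamma> / \<beta>\<^sub>g)\<^sup>2) * (norm d)\<^sup>2"
    by (simp add: algebra_simps)
  \<comment> \<open>\<open>sqrt\<close> is monotone and multiplicative on all reals, being extended
    as an odd function, so the sign of the radicand need not be settled.\<close>
  then have "sqrt ((norm (z (k + 1) - zstar))\<^sup>2)
      \<le> sqrt ((1 - 4 * \<gamma> * lam k * \<mu>\<^sub>g / (1 + \<gamma> / \<beta>\<^sub>g)\<^sup>2) * (norm d)\<^sup>2)"
    by (rule real_sqrt_le_mono)
  then show "norm (z (k + 1) - zstar) \<le> PRS_rate \<gamma> \<mu>\<^sub>g \<beta>\<^sub>g (lam k) * norm (z k - zstar)"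
    by (simp add: real_sqrt_mult PRS_rate_def d_def)
qed

end
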